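(* Let $\hat{\mathbf{R}}$ be the nominal realization matrix and $\hat{\mathbf{S}}$ the nominal internal stability matrix of a closed-loop linear system. Suppose the system realization is subject to an additive perturbation $\boldsymbol{\Delta}$, i.e. the perturbed realization matrix is $$\mathbf{R}(\boldsymbol{\Delta}) = \hat{\mathbf{R}} + \boldsymbol{\Delta},$$ and let $\mathbf{S}(\boldsymbol{\Delta})$ be the internal stability matrix corresponding to $\mathbf{R}(\boldsymbol{\Delta})$. Then $$\mathbf{S}(\boldsymbol{\Delta}) \;=\; \hat{\mathbf{S}}\,(I-\boldsymbol{\Delta}\hat{\mathbf{S}})^{-1} \;=\; (I-\hat{\mathbf{S}}\boldsymbol{\Delta})^{-1}\,\hat{\mathbf{S}} .$$
   Context: Signals are treated in the frequency domain, as column vectors over the field of rational functions in the transform variable; transfer matrices are matrices over this field, and $\boldsymbol{\Delta}$ is a square transfer matrix of the same size as $\hat{\mathbf{R}}$. A closed-loop linear system has an internal state $\boldsymbol{\eta}$ (stacking all signals) and an arbitrary external disturbance $\mathbf{d}$ of the same dimension. A realization matrix $\mathbf{R}$ and its corresponding internal stability matrix $\mathbf{S}$ are square transfer matrices such that for every $\mathbf{d}$ the internal state satisfies $\boldsymbol{\eta} = \mathbf{R}\boldsymbol{\eta} + \mathbf{d}$ and $\boldsymbol{\eta} = \mathbf{S}\mathbf{d}$; equivalently $(I-\mathbf{R})\mathbf{S}=\mathbf{S}(I-\mathbf{R})=I$. Both the nominal pair $(\hat{\mathbf{R}},\hat{\mathbf{S}})$ and the perturbed pair $(\mathbf{R}(\boldsymbol{\Delta}),\mathbf{S}(\boldsymbol{\Delta}))$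 are assumed to exist in this sense. *)

theory Defs
  imports
    "HOL-Analysis.Analysis"
    "HOL-Computational_Algebra.Polynomial"
    "HOL-Computational_Algebra.Fraction_Field"
begin

text \<open>The coefficient field of the rational functions is left arbitrary; it is the reals or the
  complex numbers in the usual applications.\<close>

type_synonym 'k ratfun = "'k poly fract"

type_synonym ('k, 'n) signal = "('k ratfun, 'n) vec"

type_synonym ('k, 'n) transfer_matrix = "(('k ratfun, 'n) vec, 'n) vec"

text \<open>For each disturbance \<open>d\<close> the internal state is the signal \<open>\<eta>\<close> determined by the closed loop
  \<open>\<eta> = R \<eta> + d\<close>, and the internal stability matrix is the map from \<open>d\<close> to this \<open>\<eta>\<close>. Hence
  \<open>S d\<close> is required to solve the loop equation and to be its only solution. This amounts to
  \<open>(I - R) S = S (I - R) = I\<close>.\<close>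

definition is_internal_stability_matrix ::
    "('k::field, 'n::finite) transfer_matrix \<Rightarrow> ('k, 'n) transfer_matrix \<Rightarrow> bool" where
  "is_internal_stability_matrix R S \<longleftrightarrow>
     (\<forall>(d :: ('k, 'n) signal) (\<eta> :: ('k, 'n) signal). \<eta> = R *v \<eta> + d \<longleftrightarrow> \<eta> = S *v d)"

end

theory Submission
  imports Defs
begin

text \<open>
  An internal stability matrix of \<open>R\<close> is a two-sided inverse of the return difference \<open>I - R\<close>.
  Since \<open>S_hat\<close> inverts \<open>I - R_hat\<close>, the matrix \<open>I - \<Delta> S_hat\<close> equals \<open>((I - R_hat) - \<Delta>) S_hat\<close>, so it is the
  perturbed return difference multiplied on the right by \<open>S_hat\<close>; symmetrically, \<open>I - S_hat \<Delta>\<close> is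
  the same return difference multiplied on the left by \<open>S_hat\<close>. Both are therefore products of
  invertible matrices, and cancelling \<open>S_hat\<close> against its inverse leaves the inverse of the
  perturbed return difference, which is the perturbed stability matrix.
\<close>

lemma matrix_diff_rdistrib:
  fixes A B :: "'a::ring_1 ^ 'n ^ 'm" and C :: "'a ^ 'p ^ 'n"
  shows "(A - B) ** C = A ** C - B ** C"
  by (simp add: matrix_matrix_mult_def vec_eq_iff left_diff_distrib sum_subtractf)

lemma matrix_diff_ldistrib:
  fixes A :: "'a::ring_1 ^ 'n ^ 'm" and B C :: "'a ^ 'p ^ 'n"
  shows "A ** (B - C) = A ** B - A ** C"
  by (simp add: matrix_matrix_mult_def vec_eq_iff right_diff_distrib sum_subtractf)

lemma matrix_inv_unique_two_sided:
  fixes A B :: "'a::semiring_1 ^ 'n ^ 'n"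
  assumes "A ** B = mat 1" and "B ** A = mat 1"
  shows "invertible A" and "matrix_inv A = B"
proof -
  show "invertible A"
    using assms by (auto simp: invertible_def)
  have "A ** matrix_inv A = mat 1 \<and> matrix_inv A ** A = mat 1"
    unfolding matrix_inv_def by (rule someI[of _ B]) (use assms in blast)
  then have "matrix_inv A = (B ** A) ** matrix_inv A" "A ** matrix_inv A = mat 1"
    using assms by simp_all
  then show "matrix_inv A = B"
    by (metis matrix_mul_assoc matrix_mul_rid)
qed

text \<open>Existence of a solution for every disturbance makes \<open>S\<close> a right inverse of \<open>I - R\<close>.
  Its uniqueness makes \<open>S\<close> a left inverse: an arbitrary \<open>\<eta>\<close> is the state
  belonging to the disturbance \<open>(I - R) \<eta>\<close>.\<close>

lemma internal_stability_matrix_inverse: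
  assumes "is_internal_stability_matrix R S"
  shows "(mat 1 - R) ** S = mat 1" and "S ** (mat 1 - R) = mat 1"
proof -
  have loop: "\<eta> = R *v \<eta> + d \<longleftrightarrow> \<eta> = S *v d" for \<eta> d
    using assms by (simp add: is_internal_stability_matrix_def)
  have "((mat 1 - R) ** S) *v d = mat 1 *v d" for d
  proof -
    have "S *v d = R *v (S *v d) + d"
      using loop by blast
    then show ?thesis
      by (simp add: matrix_vector_mul_assoc[symmetric] matrix_vector_mult_diff_rdistrib
          algebra_simps)
  qed
  then show "(mat 1 - R) ** S = mat 1"
    by (subst matrix_eq) blast
  have "(S ** (mat 1 - R)) *v \<eta> = mat 1 *v \<eta>" for \<eta>
  proof -
    have "\<eta> = R *v \<eta> + (mat 1 - R) *v \<eta>"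
      by (simp add: matrix_vector_mult_diff_rdistrib)
    then have "\<eta> = S *v ((mat 1 - R) *v \<eta>)"
      using loop by blast
    then show ?thesis
      by (simp add: matrix_vector_mul_assoc)
  qed
  then show "S ** (mat 1 - R) = mat 1"
    by (subst matrix_eq) blast
qed

theorem lemma3:
  fixes R_hat S_hat \<Delta> R_\<Delta> S_\<Delta> :: "('k::field, 'n::finite) transfer_matrix"
  assumes nominal: "is_internal_stability_matrix R_hat S_hat"
    and perturbation: "R_\<Delta> = R_hat + \<Delta>"
    and perturbed: "is_internal_stability_matrix R_\<Delta> S_\<Delta>"
  shows "invertible (mat 1 - \<Delta> ** S_hat) \<and>
         invertible (mat 1 - S_hat ** \<Delta>) \<and>
         S_\<Delta> = S_hat ** matrix_inv (mat 1 - \<Delta> ** S_hat) \<and>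
         S_\<Delta> = matrix_inv (mat 1 - S_hat ** \<Delta>) ** S_hat"
proof -
  define A where "A = mat 1 - R_hat"
  define B where "B = mat 1 - R_\<Delta>"
  have A: "A ** S_hat = mat 1" "S_hat ** A = mat 1"
    using internal_stability_matrix_inverse[OF nominal] by (simp_all add: A_def)
  have B: "B ** S_\<Delta> = mat 1" "S_\<Delta> ** B = mat 1"
    using internal_stability_matrix_inverse[OF perturbed] by (simp_all add: B_def)
  have B_eq: "B = A - \<Delta>"
    by (simp add: A_def B_def perturbation)
  have right: "mat 1 - \<Delta> ** S_hat = B ** S_hat"
    by (simp add: B_eq matrix_diff_rdistrib A)
  have left: "mat 1 - S_hat ** \<Delta> = S_hat ** B"
    by (simp add: B_eq matrix_diff_ldistrib A)
  have "(B ** S_hat) ** (A ** S_\<Delta>) = mat 1" "(A ** S_\<Delta>) ** (B ** S_hat) = mat 1"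
    by (metis A B matrix_mul_assoc matrix_mul_lid)+
  note inv_right = matrix_inv_unique_two_sided[OF this]
  have "(S_hat ** B) ** (S_\<Delta> ** A) = mat 1" "(S_\<Delta> ** A) ** (S_hat ** B) = mat 1"
    by (metis A B matrix_mul_assoc matrix_mul_lid)+
  note inv_left = matrix_inv_unique_two_sided[OF this]
  have "S_hat ** (A ** S_\<Delta>) = S_\<Delta>" "(S_\<Delta> ** A) ** S_hat = S_\<Delta>"
    by (metis A matrix_mul_assoc matrix_mul_lid matrix_mul_rid)+
  then show ?thesis
    using inv_right inv_left by (simp add: right left)
qed

end
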